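(* Consider the TASEP on $\mathbb Z$ with the step initial condition. Let $P_t$ be the total number of jumps made by all particles up to time $t$, let $a_t$ be the number of active particles at time $t$, and let $g(t)=\mathbb E\,P_t$ for $t\ge0$. Then $g$ is differentiable at every $t>0$ and $$g'(t)=\mathbb E\,a_t,\qquad t>0 .$$
   Context: TASEP (totally asymmetric simple exclusion process) on $\mathbb Z$ with the step initial condition: at time $0$ there is exactly one particle at each of the sites $0,-1,-2,\dots$ and the sites $1,2,3,\dots$ are empty. At any time each site holds at most one particle. Each particle waits an Exponential(1) time (its clock) and then, if the site immediately to its right is empty, jumps to that site; if that site is occupied, the particle does not move; in either case its clock then restarts. All clocks (successive clocks of the same particle and clocks of different particles) are mutually independent. Equivalently, particles are numbered $r=1,2,\dots$ from right to left (particle $r$ starts at site $1-r$), particle $r$ carries a rate-1 Poisson process of clock rings, these Poisson processes are independent for different $r$, and at each ring of its clock particle $r$ moves one step right if and only if the site to its right is not occupied (for $r\ge 2$, not occupied by particle $r-1$; particle $1$ is never blocked). Let $X(k,t)$ be the indicator that there is a particle at site $k$ at time $t$. The number of active particles (those whose right-neighbouring site is empty) at time $t$ is $a_t=\sum_{k\in\mathbb Z}X(k,t)\bigl(1-X(k+1,t)\bigr)$. Let $N_t^{(r)}$ be the number of jumps (actual moves) of particle $r$ in $[0,t]$; the total number of jumps up to time $t$ is $P_t=\sum_{r\ge1}N_t^{(r)}$. Equivalently, with $S(k,t)=\sum_{i>k}X(i,t)$, $P_t=\sum_{k\in\mathbb Z}\bigl(S(k,t)-S(k,0)\bigr)$.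 *)

theory Defs
  imports "HOL-Probability.Probability"
begin

text \<open>
  A realisation of all clocks is a family \<open>w\<close> where \<open>w r n\<close> is the waiting time of particle \<open>r\<close>
  that ends with its ring number \<open>n\<close>. Rings and particles are counted from \<open>0\<close>: particle \<open>r\<close> is the
  \<open>(r + 1)\<close>-st particle from the right and starts at site \<open>-r\<close>.
\<close>

type_synonym clocks = "nat \<Rightarrow> nat \<Rightarrow> real"

definition ring_time :: "clocks \<Rightarrow> nat \<Rightarrow> nat \<Rightarrow> real" where
  "ring_time w r n = (\<Sum>j\<le>n. w r j)"

text \<open>
  For exponential clocks these sets are almost surely finite, so the value \<open>0\<close> that \<open>card\<close>
  takes on infinite sets only matters on a null set. The same holds for \<open>jumps\<close> below.
\<close>

definition rings_before :: "clocks \<Rightarrow> nat \<Rightarrow> real \<Rightarrow> nat" where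
  "rings_before w r s = card {n. ring_time w r n < s}"

definition rings_until :: "clocks \<Rightarrow> nat \<Rightarrow> real \<Rightarrow> nat" where
  "rings_until w r t = card {n. ring_time w r n \<le> t}"

text \<open>
  \<open>site_after w r n\<close> is the site of particle \<open>r\<close> after its first \<open>n\<close> rings. At the ring with
  index \<open>n\<close>, particle \<open>Suc r\<close> stays put iff the site to its right is the one that particle \<open>r\<close>
  occupies immediately before that time. (Two particles almost surely never ring simultaneously.)
\<close>

fun site_after :: "clocks \<Rightarrow> nat \<Rightarrow> nat \<Rightarrow> int" where
  "site_after w r 0 = - int r"
| "site_after w 0 (Suc n) = site_after w 0 n + 1"
| "site_after w (Suc r) (Suc n) =
    (if site_after w r (rings_before w r (ring_time w (Suc r) n)) = site_after w (Suc r) n + 1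
     then site_after w (Suc r) n
     else site_after w (Suc r) n + 1)"

definition position :: "clocks \<Rightarrow> nat \<Rightarrow> real \<Rightarrow> int" where
  "position w r t = site_after w r (rings_until w r t)"

definition occupation :: "clocks \<Rightarrow> int \<Rightarrow> real \<Rightarrow> real" where
  "occupation w k t = (if \<exists>r. position w r t = k then 1 else 0)"

text \<open>
  The two sums below are taken in \<open>[0, \<infinity>]\<close>, so that they are meaningful without any
  summability assumption.
\<close>

definition active_count :: "clocks \<Rightarrow> real \<Rightarrow> ennreal" where
  "active_count w t =
    (\<Sum>\<^sub>\<infinity>k\<in>UNIV. ennreal (occupation w k t * (1 - occupation w (k + 1) t)))"

definition jumps :: "clocks \<Rightarrow> nat \<Rightarrow> real \<Rightarrow> nat" where
  "jumps w r t = card {n. ring_time w r n \<le> t \<and> site_after w r (Suc n) \<noteq> site_after w r n}"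

definition total_jumps :: "clocks \<Rightarrow> real \<Rightarrow> ennreal" where
  "total_jumps w t = (\<Sum>r. of_nat (jumps w r t))"

locale tasep_clocks = prob_space M for M :: "'a measure" +
  fixes W :: "nat \<Rightarrow> nat \<Rightarrow> 'a \<Rightarrow> real"
  assumes waiting_time_exponential: "\<And>r n. distributed M lborel (W r n) (exponential_density 1)"
    and waiting_times_indep: "indep_vars (\<lambda>_. borel) (\<lambda>(r, n). W r n) UNIV"

definition tasep_P :: "(nat \<Rightarrow> nat \<Rightarrow> 'a \<Rightarrow> real) \<Rightarrow> real \<Rightarrow> 'a \<Rightarrow> ennreal" where
  "tasep_P W t \<omega> = total_jumps (\<lambda>r n. W r n \<omega>) t"

definition tasep_a :: "(nat \<Rightarrow> nat \<Rightarrow> 'a \<Rightarrow> real) \<Rightarrow> real \<Rightarrow> 'a \<Rightarrow> ennreal" where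
  "tasep_a W t \<omega> = active_count (\<lambda>r n. W r n \<omega>) t"

definition expected_jumps ::
    "'a measure \<Rightarrow> (nat \<Rightarrow> nat \<Rightarrow> 'a \<Rightarrow> real) \<Rightarrow> real \<Rightarrow> ennreal" where
  "expected_jumps M W t = (\<integral>\<^sup>+\<omega>. tasep_P W t \<omega> \<partial>M)"

end

theory Submission
  imports Defs
begin

text \<open>
  Let \<open>W\<close> be exponential and independent of \<open>Y\<close>. Then \<open>h(W, Y)\<close> and the integral of \<open>h(u, Y)\<close> over
  \<open>0 \<le> u < W\<close> have the same mean, because \<open>P(W > u)\<close> equals the density of \<open>W\<close> at \<open>u\<close>. Apply this to
  the waiting time before each ring of particle \<open>r\<close>: the earlier rings of \<open>r\<close> and all particles to
  its right are independent of it and determine whether a ring at a given time would be a jump.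
  Summing over the rings, the expected number of jumps of particle \<open>r\<close> up to time \<open>t\<close> is the integral
  over \<open>[0, t]\<close> of the probability that \<open>r\<close> is active.

  Each of these probabilities is continuous in time, because almost surely no clock rings at a given
  time. Particle \<open>r\<close> can only be active at time \<open>s\<close> if all particles to its right have rung, so its
  probability is at most \<open>(1 - exp (- s)) ^ r\<close>. Hence the sum over \<open>r\<close> converges locally uniformly, its
  limit \<open>E a\<^sub>s\<close> is continuous, and the fundamental theorem of calculus applies.
\<close>

subsection \<open>Trajectories of proper clocks\<close>

text \<open>The almost sure event on which all pathwise arguments run. Finiteness keeps
  \<open>card\<close> in the ring counts away from its default value \<open>0\<close> on infinite
  sets.\<close>

definition proper_clocks :: "clocks \<Rightarrow> bool" where
  "proper_clocks w \<longleftrightarrow> (\<forall>r n. 0 < w r n) \<and> (\<forall>r t. finite {n. ring_time w r n \<le> t})"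

text \<open>
  \<open>can_jump w r n s\<close> says whether a ring at the hypothetical time \<open>s\<close> would be a jump if \<open>r\<close> had rung \<open>n\<close>
  times before. As \<open>s\<close> is a free argument, this does not involve the waiting time \<open>w r n\<close>.
\<close>

definition can_jump :: "clocks \<Rightarrow> nat \<Rightarrow> nat \<Rightarrow> real \<Rightarrow> bool" where
  "can_jump w r n s \<longleftrightarrow>
    r = 0 \<or> site_after w (r - 1) (rings_before w (r - 1) s) \<noteq> site_after w r n + 1"

text \<open>Only the predecessor is consulted. As the particles stay ordered, this agrees with the
  right-neighbouring site being empty; see \<open>active_count_eq\<close>.\<close>

definition active :: "clocks \<Rightarrow> nat \<Rightarrow> real \<Rightarrow> bool" where
  "active w r s \<longleftrightarrow> r = 0 \<or> position w (r - 1) s \<noteq> position w r s + 1"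

section \<open>Moves at rings and their dependence on the clocks\<close>

lemma site_after_Suc:
  "site_after w r (Suc n) =
    (if can_jump w r n (ring_time w r n) then site_after w r n + 1 else site_after w r n)"
  by (cases r) (auto simp: can_jump_def)

lemma site_after_mono: "m \<le> n \<Longrightarrow> site_after w r m \<le> site_after w r n"
  by (rule lift_Suc_mono_le) (auto simp: site_after_Suc)

lemma ring_time_eq: "ring_time w r n = (\<Sum>j<n. w r j) + w r n"
  by (simp add: ring_time_def lessThan_Suc_atMost[symmetric])

lemma ring_time_Suc: "ring_time w r (Suc n) = ring_time w r n + w r (Suc n)"
  by (simp add: ring_time_def)

lemma site_after_cong:
  assumes "\<And>q j. q < r \<Longrightarrow> w q j = w' q j" "\<And>j. j < n \<Longrightarrow> w r j = w' r j"
  shows "site_after w r n = site_after w' r n"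
  using assms
proof (induction r arbitrary: n)
  case 0
  have "site_after v 0 n = int n" for v
    by (induction n) auto
  then show ?case by simp
next
  case (Suc r)
  have rt: "ring_time w r n = ring_time w' r n" for n
    using Suc.prems(1) by (simp add: ring_time_def)
  then have rb: "rings_before w r s = rings_before w' r s" for s
    by (simp add: rings_before_def)
  have sa: "site_after w r n = site_after w' r n" for n
    using Suc by simp
  from Suc.prems(2) show ?case
  proof (induction n)
    case (Suc n)
    have "ring_time w (Suc r) n = ring_time w' (Suc r) n"
      using Suc.prems by (simp add: ring_time_def)
    with Suc show ?case by (simp add: rb sa)
  qed simp
qed

text \<open>The predictability behind the compensator: only the particles ahead and the earlier
  waiting times of \<open>r\<close> enter, so the event at a fixed \<open>s\<close> is independent
  of \<open>W r n\<close>.\<close>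

lemma can_jump_cong:
  assumes "\<And>q j. q < r \<Longrightarrow> w q j = w' q j" "\<And>j. j < n \<Longrightarrow> w r j = w' r j"
  shows "can_jump w r n s = can_jump w' r n s"
proof (cases r)
  case (Suc q)
  have "rings_before w q s = rings_before w' q s"
    using assms(1) Suc by (simp add: rings_before_def ring_time_def)
  moreover have "site_after w q m = site_after w' q m" for m
    using assms(1) Suc by (intro site_after_cong) auto
  moreover have "site_after w r n = site_after w' r n"
    using assms by (rule site_after_cong)
  ultimately show ?thesis by (simp add: can_jump_def Suc)
qed (simp add: can_jump_def)

text \<open>Serves to turn the cardinalities in the ring counts into thresholds for the ring
  index.\<close>

lemma down_closed_eq_lessThan:
  fixes A :: "nat set"
  assumes "finite A" "\<And>m n. m \<le> n \<Longrightarrow> n \<in> A \<Longrightarrow> m \<in> A"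
  shows "A = {..<card A}"
proof -
  have "A = {..<k}" if k: "k = (LEAST n. n \<notin> A)" for k
  proof -
    have "\<exists>n. n \<notin> A" using assms(1) by (rule ex_new_if_finite[OF infinite_UNIV_nat])
    then have "k \<notin> A" unfolding k by (rule LeastI_ex)
    moreover have "n \<in> A" if "n < k" for n using not_less_Least[of n "\<lambda>n. n \<notin> A"] that k by simp
    moreover have "n < k" if "n \<in> A" for n
      using assms(2)[of k n] that \<open>k \<notin> A\<close> by (cases "n < k") auto
    ultimately show ?thesis by auto
  qed
  then show ?thesis by (metis card_lessThan)
qed

section \<open>Pathwise facts for proper clocks\<close>

context
  fixes w :: clocks
  assumes proper: "proper_clocks w"
begin

lemma proper_pos: "0 < w r n"
  using proper by (simp add: proper_clocks_def)

lemma ring_time_less: "m < n \<Longrightarrow> ring_time w r m < ring_time w r n"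
  by (rule lift_Suc_mono_less) (simp_all add: ring_time_Suc proper_pos)

lemma ring_time_le: "m \<le> n \<Longrightarrow> ring_time w r m \<le> ring_time w r n"
  using ring_time_less[of m n r] by (cases "m = n") auto

lemma ring_time_pos: "0 < ring_time w r n"
  unfolding ring_time_def by (rule sum_pos) (auto simp: proper_pos)

lemma ring_set_finite: "finite {n. ring_time w r n \<le> t}"
  using proper by (simp add: proper_clocks_def)

lemma ring_time_le_iff: "ring_time w r n \<le> t \<longleftrightarrow> n < rings_until w r t"
proof -
  have "{n. ring_time w r n \<le> t} = {..<rings_until w r t}"
    unfolding rings_until_def
    by (rule down_closed_eq_lessThan) (auto simp: ring_set_finite intro: order_trans[OF ring_time_le])
  then show ?thesis by blast
qed

lemma ring_time_less_iff: "ring_time w r n < t \<longleftrightarrow> n < rings_before w r t"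
proof -
  have "finite {n. ring_time w r n < t}"
    by (rule finite_subset[OF _ ring_set_finite[of r t]]) auto
  then have "{n. ring_time w r n < t} = {..<rings_before w r t}"
    unfolding rings_before_def
    by (rule down_closed_eq_lessThan) (auto intro: le_less_trans[OF ring_time_le])
  then show ?thesis by blast
qed

lemma rings_until_mono: "s \<le> t \<Longrightarrow> rings_until w r s \<le> rings_until w r t"
  using ring_time_le_iff[of r "rings_until w r t" s] ring_time_le_iff[of r "rings_until w r t" t]
  by linarith

lemma rings_before_le_until: "rings_before w r s \<le> rings_until w r s"
  using ring_time_le_iff[of r "rings_until w r s" s] ring_time_less_iff[of r "rings_until w r s" s]
  by linarith

lemma rings_until_le_before: "s < t \<Longrightarrow> rings_until w r s \<le> rings_before w r t"
  using ring_time_le_iff[of r "rings_before w r t" s] ring_time_less_iff[of r "rings_before w r t" t]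
  by linarith

lemma rings_before_eq_until:
  "(\<And>n. ring_time w r n \<noteq> s) \<Longrightarrow> rings_before w r s = rings_until w r s"
  unfolding rings_before_def rings_until_def by (simp add: less_le)

text \<open>Consecutive rings cut the half-line from \<open>0\<close> into half-open intervals.
  Writing the left end as a sum over \<open>j < n\<close> covers \<open>n = 0\<close> too, where the
  sum is empty and \<open>0 \<le> s\<close> is used.\<close>

lemma rings_until_eq_iff:
  assumes "0 \<le> s"
  shows "rings_until w r s = n \<longleftrightarrow> (\<Sum>j<n. w r j) \<le> s \<and> s < ring_time w r n"
proof -
  have "s < ring_time w r n \<longleftrightarrow> rings_until w r s \<le> n"
    using ring_time_le_iff[of r n s] by linarith
  moreover have "(\<Sum>j<n. w r j) \<le> s \<longleftrightarrow> n \<le> rings_until w r s"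
  proof (cases n)
    case 0 then show ?thesis using assms by simp
  next
    case (Suc m)
    then have "(\<Sum>j<n. w r j) = ring_time w r m"
      by (simp add: ring_time_def lessThan_Suc_atMost)
    then show ?thesis using ring_time_le_iff[of r m s] Suc by auto
  qed
  ultimately show ?thesis by auto
qed

text \<open>Exclusion: a follower never reaches the particle ahead. \<open>s\<close> is any time
  from the follower's latest counted ring on, because the particle ahead only moves right.\<close>

lemma site_after_order:
  assumes "n = 0 \<or> ring_time w (Suc r) (n - 1) \<le> s"
  shows "site_after w (Suc r) n < site_after w r (rings_until w r s)"
  using assms
proof (induction n arbitrary: s)
  case 0
  show ?case using site_after_mono[of 0 "rings_until w r s" w r] by simp
next
  case (Suc n)
  let ?T = "ring_time w (Suc r) n"
  \<comment> \<open>The follower's previous ring, or the start. It precedes \<open>?T\<close>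
    strictly, so the order at \<open>u\<close> persists until just before \<open>?T\<close>.\<close>
  define u where "u = (if n = 0 then 0 else ring_time w (Suc r) (n - 1))"
  have "u < ?T" unfolding u_def by (auto simp: ring_time_pos intro!: ring_time_less)
  moreover have "site_after w (Suc r) n < site_after w r (rings_until w r u)"
    by (rule Suc.IH) (auto simp: u_def)
  ultimately have "site_after w (Suc r) n < site_after w r (rings_before w r ?T)"
    using site_after_mono[OF rings_until_le_before[of u ?T r], of w r] by simp
  \<comment> \<open>A jump onto the site of particle \<open>r\<close> is suppressed by the
    definition, so the integer inequality stays strict.\<close>
  then have "site_after w (Suc r) (Suc n) < site_after w r (rings_before w r ?T) + 0"
    by auto
  also have "\<dots> \<le> site_after w r (rings_until w r s)"
    using Suc.prems rings_before_le_until[of r ?T] rings_until_mono[of ?T s r]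
    by (simp add: site_after_mono)
  finally show ?case by simp
qed

lemma position_Suc_less: "position w (Suc r) s < position w r s"
  unfolding position_def
proof (rule site_after_order)
  show "rings_until w (Suc r) s = 0 \<or> ring_time w (Suc r) (rings_until w (Suc r) s - 1) \<le> s"
    unfolding ring_time_le_iff by linarith
qed

lemma position_strict_antimono: "q < r \<Longrightarrow> position w r s < position w q s"
proof (induction r)
  case (Suc r)
  then show ?case
    using position_Suc_less[of r s] by (cases "q = r") auto
qed simp

lemma position_ge: "- int r \<le> position w r s"
  unfolding position_def using site_after_mono[of 0 "rings_until w r s" w r] by simp

text \<open>A particle still at its start jams everything behind it: the strict order and
  \<open>position_ge\<close> leave each follower only its initial site.\<close>

lemma position_eq_of_le:
  assumes "position w q s = - int q" "q \<le> r"
  shows "position w r s = - int r"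
  using assms(2)
proof (induction r rule: dec_induct)
  case base show ?case by (fact assms)
next
  case (step n)
  then show ?case using position_Suc_less[of n s] position_ge[of "Suc n" s] by simp
qed

text \<open>If \<open>q\<close> has not rung, the particles from \<open>q\<close> to
  \<open>r\<close> form an unmoved block in which \<open>r - 1\<close> blocks
  \<open>r\<close>.\<close>

lemma active_imp_rung:
  assumes "active w r s" "q < r"
  shows "w q 0 \<le> s"
proof (rule ccontr)
  assume "\<not> ?thesis"
  then have "rings_until w q s = 0"
    using ring_time_le_iff[of q 0 s] by (simp add: ring_time_def)
  then have "position w q s = - int q" by (simp add: position_def)
  then have "position w (r - 1) s = - int (r - 1)" "position w r s = - int r"
    using assms(2) position_eq_of_le[of q s "r - 1"] position_eq_of_le[of q s r] by linarith+
  with assms show False by (auto simp: active_def)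
qed

text \<open>\<open>can_jump\<close> sees the predecessor just before \<open>s\<close>,
  \<open>active\<close> sees it at \<open>s\<close>; the two can differ only if a clock rings at
  \<open>s\<close>.\<close>

lemma can_jump_iff_active:
  assumes "\<And>r n. ring_time w r n \<noteq> s"
  shows "can_jump w r (rings_until w r s) s \<longleftrightarrow> active w r s"
  using assms by (simp add: can_jump_def active_def position_def rings_before_eq_until)

lemma eventually_rings_until:
  assumes "\<And>n. ring_time w r n \<noteq> s"
  shows "\<forall>\<^sub>F t in nhds s. rings_until w r t = rings_until w r s"
proof -
  define n where "n = rings_until w r s"
  have "s < ring_time w r n"
    using ring_time_le_iff[of r n s] by (simp add: n_def)
  then have "\<forall>\<^sub>F t in nhds s. t < ring_time w r n"
    by (rule order_tendstoD[OF filterlim_ident])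
  moreover have "\<forall>\<^sub>F t in nhds s. n = 0 \<or> ring_time w r (n - 1) < t"
  proof (cases "n = 0")
    case False
    then have "ring_time w r (n - 1) < s"
      using ring_time_le_iff[of r "n - 1" s] assms[of "n - 1"] by (simp add: n_def)
    then have "\<forall>\<^sub>F t in nhds s. ring_time w r (n - 1) < t"
      by (rule order_tendstoD[OF filterlim_ident])
    then show ?thesis by (rule eventually_mono) simp
  qed simp
  ultimately show ?thesis
  proof eventually_elim
    case (elim t)
    have "\<not> n < rings_until w r t" using elim(1) ring_time_le_iff[of r n t] by linarith
    moreover have "n = 0 \<or> n - 1 < rings_until w r t"
      using elim(2) ring_time_le_iff[of r "n - 1" t] by linarith
    ultimately show ?case unfolding n_def by linarith
  qed
qed

lemma eventually_active:
  assumes "\<And>r n. ring_time w r n \<noteq> s"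
  shows "\<forall>\<^sub>F t in nhds s. active w r t \<longleftrightarrow> active w r s"
  using eventually_rings_until[of r s, OF assms] eventually_rings_until[of "r - 1" s, OF assms]
  by eventually_elim (simp only: active_def position_def)

text \<open>Reindexes the sum over sites by particles: positions are distinct, and empty sites
  contribute \<open>0\<close>.\<close>

lemma active_count_eq: "active_count w t = (\<Sum>r. of_bool (active w r t))"
proof -
  let ?p = "\<lambda>r. position w r t"
  have inj: "inj ?p"
    by (rule linorder_injI) (auto dest: position_strict_antimono[of _ _ t])
  \<comment> \<open>Only \<open>r - 1\<close> can occupy the site to the right: if some
    \<open>q < r - 1\<close> did, \<open>r - 1\<close> would lie strictly between two adjacent
    sites.\<close>
  have free: "active w r t \<longleftrightarrow> ?p r + 1 \<notin> range ?p" for r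
  proof
    assume act: "active w r t"
    show "?p r + 1 \<notin> range ?p"
    proof
      assume "?p r + 1 \<in> range ?p"
      then obtain q where q: "?p q = ?p r + 1" by auto
      have "q < r"
        using q position_strict_antimono[of r q t] by (cases q r rule: linorder_cases) auto
      moreover have "q \<noteq> r - 1" using act q \<open>q < r\<close> by (auto simp: active_def)
      ultimately have "?p (r - 1) < ?p q" "?p r < ?p (r - 1)"
        by (auto intro!: position_strict_antimono)
      with q show False by simp
    qed
  next
    assume "?p r + 1 \<notin> range ?p"
    then have "?p (r - 1) \<noteq> ?p r + 1" by (metis rangeI)
    then show "active w r t" by (simp add: active_def)
  qed
  have occ: "occupation w (?p r) t * (1 - occupation w (?p r + 1) t) = of_bool (active w r t)" for r
  proof -
    have "\<exists>q. ?p q = ?p r" by blast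
    moreover have "(\<exists>q. ?p q = ?p r + 1) \<longleftrightarrow> \<not> active w r t"
      unfolding free by (metis rangeE rangeI)
    ultimately show ?thesis by (simp only: occupation_def if_True) simp
  qed
  have "active_count w t =
      (\<Sum>\<^sub>\<infinity>k\<in>range ?p. ennreal (occupation w k t * (1 - occupation w (k + 1) t)))"
    unfolding active_count_def
    by (rule infsum_cong_neutral) (auto simp: occupation_def)
  also have "\<dots> = (\<Sum>\<^sub>\<infinity>r. of_bool (active w r t))"
    unfolding infsum_reindex[OF inj] o_def occ by (rule infsum_cong) auto
  also have "\<dots> = (\<Sum>r. of_bool (active w r t))"
    by (intro sums_unique has_sum_imp_sums has_sum_infsum nonneg_summable_on_complete) auto
  finally show ?thesis .
qed

lemma jumps_eq:
  "of_nat (jumps w r t) =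
    (\<Sum>n. of_bool (ring_time w r n \<le> t \<and> can_jump w r n (ring_time w r n)) :: ennreal)"
proof -
  let ?A = "{n. ring_time w r n \<le> t \<and> can_jump w r n (ring_time w r n)}"
  have fin: "finite ?A"
    by (rule finite_subset[OF _ ring_set_finite[of r t]]) auto
  have "jumps w r t = card ?A"
    unfolding jumps_def by (rule arg_cong[where f = card]) (auto simp: site_after_Suc)
  moreover have "(\<Sum>n. of_bool (ring_time w r n \<le> t \<and> can_jump w r n (ring_time w r n)) :: ennreal)
      = (\<Sum>n\<in>?A. 1)"
    by (subst suminf_finite[OF fin]) auto
  ultimately show ?thesis by simp
qed

text \<open>The inter-ring intervals are disjoint and cover the nonnegative times, so only the term
  \<open>n = rings_until w r s\<close> survives.\<close>

lemma sum_over_ring_intervals: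
  "(\<Sum>n. of_bool ((\<Sum>j<n. w r j) \<le> s \<and> s < ring_time w r n \<and> 0 \<le> s \<and> can_jump w r n s)) =
    (of_bool (0 \<le> s \<and> can_jump w r (rings_until w r s) s) :: ennreal)"
proof (cases "0 \<le> s")
  case True
  have "(\<Sum>n. of_bool ((\<Sum>j<n. w r j) \<le> s \<and> s < ring_time w r n \<and> 0 \<le> s \<and> can_jump w r n s))
      = (\<Sum>n. of_bool (rings_until w r s = n \<and> can_jump w r n s) :: ennreal)"
    by (simp add: rings_until_eq_iff[OF True] True conj_assoc)
  also have "\<dots> = of_bool (can_jump w r (rings_until w r s) s)"
    by (subst suminf_finite[of "{rings_until w r s}"]) auto
  finally show ?thesis using True by simp
qed simp

end

subsection \<open>Measurability\<close>

context
  fixes N :: "'x measure" and V :: "nat \<Rightarrow> nat \<Rightarrow> 'x \<Rightarrow> real"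
  assumes V[measurable]: "\<And>r n. V r n \<in> borel_measurable N"
begin

text \<open>The space and the clocks are kept general: later uses include the sample space, its
  product with time, a product space of waiting times, and constant clocks.\<close>

lemma measurable_ring_time: "(\<lambda>x. ring_time (\<lambda>r n. V r n x) r n) \<in> borel_measurable N"
  unfolding ring_time_def by measurable

lemmas [measurable] = measurable_ring_time

lemma measurable_rings_before:
  assumes [measurable]: "f \<in> borel_measurable N"
  shows "(\<lambda>x. rings_before (\<lambda>r n. V r n x) r (f x)) \<in> measurable N (count_space UNIV)"
  unfolding rings_before_def by (rule measurable_card) simp

lemma measurable_rings_until:
  assumes [measurable]: "f \<in> borel_measurable N"
  shows "(\<lambda>x. rings_until (\<lambda>r n. V r n x) r (f x)) \<in> measurable N (count_space UNIV)"
  unfolding rings_until_def by (rule measurable_card) simp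

lemmas [measurable] = measurable_rings_before measurable_rings_until

lemma measurable_site_after:
  "(\<lambda>x. site_after (\<lambda>r n. V r n x) r n) \<in> measurable N (count_space UNIV)"
proof (induction r arbitrary: n)
  case 0
  show ?case by (induction n) simp_all
next
  case (Suc r)
  note Suc.IH[measurable]
  show ?case
  proof (induction n)
    case (Suc n)
    note Suc.IH[measurable]
    \<comment> \<open>The number of rings is a random index with countably many values, so
      measurability for each fixed index suffices.\<close>
    have [measurable]: "(\<lambda>x. site_after (\<lambda>r n. V r n x) r
        (rings_before (\<lambda>r n. V r n x) r (ring_time (\<lambda>r n. V r n x) (Suc r) n)))
        \<in> measurable N (count_space UNIV)"
      by (rule measurable_compose_countable) measurable
    show ?case by simp
  qed simp
qed

lemmas [measurable] = measurable_site_after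

lemma measurable_site_after_random:
  assumes [measurable]: "g \<in> measurable N (count_space UNIV)"
  shows "(\<lambda>x. site_after (\<lambda>r n. V r n x) r (g x)) \<in> measurable N (count_space UNIV)"
  by (rule measurable_compose_countable) measurable

lemmas [measurable] = measurable_site_after_random

lemma measurable_position:
  assumes [measurable]: "f \<in> borel_measurable N"
  shows "(\<lambda>x. position (\<lambda>r n. V r n x) r (f x)) \<in> measurable N (count_space UNIV)"
  unfolding position_def by measurable

lemmas [measurable] = measurable_position

lemma measurable_can_jump:
  assumes [measurable]: "f \<in> borel_measurable N" "g \<in> measurable N (count_space UNIV)"
  shows "Measurable.pred N (\<lambda>x. can_jump (\<lambda>r n. V r n x) r (g x) (f x))"
  unfolding can_jump_def by measurable

lemma measurable_active:
  assumes [measurable]: "f \<in> borel_measurable N"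
  shows "Measurable.pred N (\<lambda>x. active (\<lambda>r n. V r n x) r (f x))"
  unfolding active_def by measurable

lemma measurable_total_jumps: "(\<lambda>x. total_jumps (\<lambda>r n. V r n x) t) \<in> borel_measurable N"
  unfolding total_jumps_def jumps_def by measurable

lemma measurable_active_count: "(\<lambda>x. active_count (\<lambda>r n. V r n x) t) \<in> borel_measurable N"
proof -
  have [measurable]: "(\<lambda>x. occupation (\<lambda>r n. V r n x) k t) \<in> borel_measurable N" for k
    unfolding occupation_def by measurable
  have "infsum f UNIV = (\<Sum>n. f (int_decode n))" for f :: "int \<Rightarrow> ennreal"
  proof -
    have "infsum f UNIV = (\<Sum>\<^sub>\<infinity>n. f (int_decode n))"
      by (rule infsum_reindex_bij_betw[symmetric]) (rule bij_int_decode)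
    also have "\<dots> = (\<Sum>n. f (int_decode n))"
      by (intro sums_unique has_sum_imp_sums has_sum_infsum nonneg_summable_on_complete) auto
    finally show ?thesis .
  qed
  then show ?thesis unfolding active_count_def by simp
qed

end

declare measurable_ring_time[measurable (raw)] measurable_rings_until[measurable (raw)]
  measurable_can_jump[measurable (raw)] measurable_active[measurable (raw)]

lemma measurable_can_jump_at: "Measurable.pred borel (can_jump w r n)"
  by (rule measurable_can_jump[where V = "\<lambda>a b _. w a b" and f = "\<lambda>s. s" and g = "\<lambda>_. n"]) simp_all

subsection \<open>The compensator of an exponential clock\<close>

text \<open>After Fubini the integrand at \<open>u \<ge> 0\<close> is \<open>h u\<close> times the
  tail probability at \<open>u\<close>, which is \<open>exp (- u)\<close>, the density.\<close>

lemma (in prob_space) exponential_layer: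
  fixes h :: "real \<Rightarrow> ennreal"
  assumes D: "distributed M lborel X (exponential_density 1)"
    and [measurable]: "h \<in> borel_measurable borel"
  shows "(\<integral>\<^sup>+x. h x \<partial>distr M borel X) =
    (\<integral>\<^sup>+x. (\<integral>\<^sup>+u. h u * indicator {0..<x} u \<partial>lborel) \<partial>distr M borel X)"
proof -
  have X[measurable]: "X \<in> borel_measurable M"
    using distributed_measurable[OF D] by simp
  have d: "distr M borel X = density lborel (exponential_density 1)"
    using distributed_distr_eq_density[OF D] by (metis distr_cong sets_lborel)
  interpret D: prob_space "distr M borel X" by (rule prob_space_distr) simp
  interpret pair_sigma_finite "distr M borel X" lborel ..
  have "(\<integral>\<^sup>+x. (\<integral>\<^sup>+u. h u * indicator {0..<x} u \<partial>lborel) \<partial>distr M borel X) =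
      (\<integral>\<^sup>+u. (\<integral>\<^sup>+x. h u * indicator {0..<x} u \<partial>distr M borel X) \<partial>lborel)"
    unfolding indicator_def atLeastLessThan_iff by (rule Fubini'[symmetric]) measurable
  also have "\<dots> = (\<integral>\<^sup>+u. exponential_density 1 u * h u \<partial>lborel)"
  proof (rule nn_integral_cong)
    fix u :: real
    have "(\<integral>\<^sup>+x. h u * indicator {0..<x} u \<partial>distr M borel X) =
        (\<integral>\<^sup>+x. h u * indicator {0..} u * indicator {u<..} x \<partial>distr M borel X)"
      by (rule nn_integral_cong) (auto split: split_indicator)
    also have "\<dots> = h u * indicator {0..} u * emeasure (distr M borel X) {u<..}"
      by (simp add: nn_integral_cmult_indicator)
    also have "emeasure (distr M borel X) {u<..} = \<P>(x in M. u < X x)"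
      by (subst emeasure_distr) (auto simp: emeasure_eq_measure intro!: arg_cong[where f = prob])
    also have "h u * indicator {0..} u * \<P>(x in M. u < X x) = exponential_density 1 u * h u"
      using exponential_distributedD_gt[OF D, of u]
      by (auto simp: exponential_density_def mult.commute split: split_indicator)
    finally show "(\<integral>\<^sup>+x. h u * indicator {0..<x} u \<partial>distr M borel X) =
      exponential_density 1 u * h u" .
  qed
  also have "\<dots> = (\<integral>\<^sup>+x. h x \<partial>distr M borel X)"
    unfolding d by (subst nn_integral_density) auto
  finally show ?thesis ..
qed

text \<open>Freeze \<open>Y\<close> and apply \<open>exponential_layer\<close>. The map \<phi> is
  there because independence of disjoint blocks of clocks yields function-valued variables, from
  which the waiting time is read off as a coordinate.\<close>

lemma (in prob_space) exponential_compensator: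
  assumes indep: "indep_var S X T Y"
    and \<phi>[measurable]: "\<phi> \<in> borel_measurable S"
    and D: "distributed M lborel (\<lambda>\<omega>. \<phi> (X \<omega>)) (exponential_density 1)"
    and h[measurable]: "h \<in> borel_measurable (borel \<Otimes>\<^sub>M T)"
  shows "(\<integral>\<^sup>+\<omega>. h (\<phi> (X \<omega>), Y \<omega>) \<partial>M) =
    (\<integral>\<^sup>+\<omega>. (\<integral>\<^sup>+u. h (u, Y \<omega>) * indicator {0..<\<phi> (X \<omega>)} u \<partial>lborel) \<partial>M)"
proof -
  have [measurable]: "X \<in> measurable M S" "Y \<in> measurable M T"
    using indep_var_rv1[OF indep] indep_var_rv2[OF indep] by auto
  let ?X = "distr M borel (\<lambda>\<omega>. \<phi> (X \<omega>))"
  interpret X: prob_space "distr M S X" by (rule prob_space_distr) simp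
  interpret X': prob_space ?X by (rule prob_space_distr) simp
  interpret Y: prob_space "distr M T Y" by (rule prob_space_distr) simp
  interpret pair_sigma_finite "distr M S X" "distr M T Y" ..
  have split: "(\<integral>\<^sup>+\<omega>. k (\<phi> (X \<omega>), Y \<omega>) \<partial>M) = (\<integral>\<^sup>+y. (\<integral>\<^sup>+x. k (x, y) \<partial>?X) \<partial>distr M T Y)"
    if [measurable]: "k \<in> borel_measurable (borel \<Otimes>\<^sub>M T)" for k
  proof -
    have "(\<integral>\<^sup>+\<omega>. k (\<phi> (X \<omega>), Y \<omega>) \<partial>M) =
        (\<integral>\<^sup>+z. k (\<phi> (fst z), snd z) \<partial>distr M (S \<Otimes>\<^sub>M T) (\<lambda>\<omega>. (X \<omega>, Y \<omega>)))"
      by (subst nn_integral_distr) auto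
    also have "\<dots> = (\<integral>\<^sup>+z. k (\<phi> (fst z), snd z) \<partial>(distr M S X \<Otimes>\<^sub>M distr M T Y))"
      using indep by (simp add: indep_var_distribution_eq)
    also have "\<dots> = (\<integral>\<^sup>+y. (\<integral>\<^sup>+x. k (\<phi> x, y) \<partial>distr M S X) \<partial>distr M T Y)"
      by (subst nn_integral_snd[symmetric]) simp_all
    also have "\<dots> = (\<integral>\<^sup>+y. (\<integral>\<^sup>+x. k (x, y) \<partial>?X) \<partial>distr M T Y)"
    proof (rule nn_integral_cong)
      fix y assume "y \<in> space (distr M T Y)"
      then have "y \<in> space T" by simp
      then have [measurable]: "(\<lambda>x. k (x, y)) \<in> borel_measurable borel" by simp
      show "(\<integral>\<^sup>+x. k (\<phi> x, y) \<partial>distr M S X) = (\<integral>\<^sup>+x. k (x, y) \<partial>?X)"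
        by (simp add: nn_integral_distr)
    qed
    finally show ?thesis .
  qed
  have "(\<integral>\<^sup>+\<omega>. h (\<phi> (X \<omega>), Y \<omega>) \<partial>M) =
      (\<integral>\<^sup>+y. (\<integral>\<^sup>+x. (\<integral>\<^sup>+u. h (u, y) * indicator {0..<x} u \<partial>lborel) \<partial>?X) \<partial>distr M T Y)"
    unfolding split[OF h]
  proof (rule nn_integral_cong, rule exponential_layer[OF D])
    fix y assume "y \<in> space (distr M T Y)"
    then have "y \<in> space T" by simp
    then show "(\<lambda>u. h (u, y)) \<in> borel_measurable borel" by simp
  qed
  also have "\<dots> = (\<integral>\<^sup>+\<omega>. (\<lambda>(x, y). \<integral>\<^sup>+u. h (u, y) * indicator {0..<x} u \<partial>lborel) (\<phi> (X \<omega>), Y \<omega>) \<partial>M)"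
    unfolding indicator_def atLeastLessThan_iff by (subst split) simp_all
  finally show ?thesis by simp
qed

subsection \<open>Exponential clocks\<close>

context tasep_clocks
begin

abbreviation clk :: "'a \<Rightarrow> clocks" where
  "clk \<omega> \<equiv> (\<lambda>r n. W r n \<omega>)"

section \<open>Almost sure regularity of the clocks\<close>

lemma measurable_W[measurable]: "W r n \<in> borel_measurable M"
  using distributed_measurable[OF waiting_time_exponential] by simp

lemma ring_time_distributed:
  "distributed M lborel (\<lambda>\<omega>. ring_time (clk \<omega>) r n) (erlang_density n 1)"
proof -
  let ?I = "{r} \<times> {..n}"
  have "distributed M lborel (\<lambda>\<omega>. \<Sum>i\<in>?I. (\<lambda>(r, n). W r n) i \<omega>) (erlang_density (card ?I - 1) 1)"
    by (rule exponential_distributed_sum)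
      (auto intro: waiting_time_exponential indep_vars_subset[OF waiting_times_indep])
  moreover have "(\<Sum>i\<in>?I. (\<lambda>(r, n). W r n) i \<omega>) = ring_time (clk \<omega>) r n" for \<omega>
  proof -
    have "(\<Sum>i\<in>?I. (\<lambda>(r, n). W r n) i \<omega>) = (\<Sum>i\<in>?I. (\<lambda>(r, n). W r n \<omega>) i)"
      by (rule sum.cong) auto
    also have "\<dots> = (\<Sum>a\<in>{r}. \<Sum>b\<le>n. W a b \<omega>)"
      by (rule sum.cartesian_product[symmetric])
    finally show ?thesis by (simp add: ring_time_def)
  qed
  ultimately show ?thesis by simp
qed

lemma AE_no_ring_at: "AE \<omega> in M. \<forall>r n. ring_time (clk \<omega>) r n \<noteq> s"
proof -
  have "AE \<omega> in M. ring_time (clk \<omega>) r n \<noteq> s" for r n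
    using AE_lborel_singleton[of s]
    by (subst distributed_AE2[OF ring_time_distributed]) auto
  then show ?thesis by (simp add: AE_all_countable)
qed

text \<open>The distribution function is one minus a partial sum of Poisson weights, whose total
  mass is one.\<close>

lemma erlang_CDF_tendsto_0:
  assumes "0 \<le> t"
  shows "(\<lambda>n. erlang_CDF n 1 t) \<longlonglongrightarrow> 0"
proof -
  have "(\<lambda>n. \<Sum>k\<le>n. t ^ k /\<^sub>R fact k) \<longlonglongrightarrow> exp t"
    using exp_converges[of t] unfolding sums_def_le .
  then have "(\<lambda>n. 1 - (\<Sum>k\<le>n. t ^ k /\<^sub>R fact k) * exp (- t)) \<longlonglongrightarrow> 1 - exp t * exp (- t)"
    by (intro tendsto_intros)
  then show ?thesis
    using assms by (simp add: erlang_CDF_def sum_distrib_left divide_inverse mult_ac exp_minus)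
qed

lemma AE_proper_clocks: "AE \<omega> in M. proper_clocks (clk \<omega>)"
proof -
  have pos: "AE \<omega> in M. 0 < W r n \<omega>" for r n
    using AE_lborel_singleton[of "0::real"]
    by (subst distributed_AE2[OF waiting_time_exponential])
      (auto simp: exponential_density_def split: if_splits elim!: eventually_mono)
  \<comment> \<open>Non-explosion: the event that all rings come by time \<open>N\<close> lies in
    each event that ring \<open>n\<close> does, whose probability tends to \<open>0\<close>. Integer
    levels keep the exceptional sets countable in number.\<close>
  have exceed: "AE \<omega> in M. \<exists>n. real N < ring_time (clk \<omega>) r n" for r N
  proof -
    let ?E = "{\<omega> \<in> space M. \<forall>n. ring_time (clk \<omega>) r n \<le> real N}"
    have "prob ?E \<le> erlang_CDF n 1 (real N)" for n
    proof -
      have "prob ?E \<le> \<P>(\<omega> in M. ring_time (clk \<omega>) r n \<le> real N)"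
        by (rule finite_measure_mono) auto
      also have "\<dots> = erlang_CDF n 1 (real N)"
        by (rule erlang_distributed_le[OF ring_time_distributed]) auto
      finally show ?thesis .
    qed
    then have "prob ?E \<le> 0"
      by (intro tendsto_lowerbound[OF erlang_CDF_tendsto_0[of "real N"]]) auto
    then have "prob ?E = 0" using measure_nonneg[of M ?E] by linarith
    then have "AE \<omega> in M. \<omega> \<notin> ?E" by (subst (asm) prob_eq_0) auto
    then show ?thesis using AE_space by eventually_elim (auto simp: not_le)
  qed
  have "AE \<omega> in M. (\<forall>r n. 0 < W r n \<omega>) \<and> (\<forall>N r. \<exists>n. real N < ring_time (clk \<omega>) r n)"
    using pos exceed by (simp add: AE_all_countable)
  then show ?thesis
  proof eventually_elim
    case (elim \<omega>)
    have mono: "ring_time (clk \<omega>) r m \<le> ring_time (clk \<omega>) r n" if "m \<le> n" for r m n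
    proof (rule lift_Suc_mono_le[OF _ that])
      show "ring_time (clk \<omega>) r n \<le> ring_time (clk \<omega>) r (Suc n)" for n
        using conjunct1[OF elim] by (simp add: ring_time_Suc less_imp_le)
    qed
    have "finite {n. ring_time (clk \<omega>) r n \<le> t}" for r t
    proof -
      obtain N where "t \<le> real N" using real_arch_simple by blast
      moreover obtain m where "real N < ring_time (clk \<omega>) r m" using elim by blast
      ultimately have "\<not> ring_time (clk \<omega>) r n \<le> t" if "m \<le> n" for n
        using mono[OF that, of r] by linarith
      then have "{n. ring_time (clk \<omega>) r n \<le> t} \<subseteq> {..<m}"
        by (auto simp: not_le[symmetric])
      then show ?thesis by (rule finite_subset) simp
    qed
    with conjunct1[OF elim] show ?case by (simp add: proper_clocks_def)
  qed
qed

section \<open>The probability that a given particle is active\<close>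

definition active_prob :: "nat \<Rightarrow> real \<Rightarrow> real" where
  "active_prob r s = (\<integral>\<omega>. of_bool (active (clk \<omega>) r s) \<partial>M)"

lemma active_prob_nonneg: "0 \<le> active_prob r s"
  unfolding active_prob_def by (rule integral_nonneg_AE) simp

lemma nn_integral_active: "(\<integral>\<^sup>+\<omega>. of_bool (active (clk \<omega>) r s) \<partial>M) = ennreal (active_prob r s)"
proof -
  have "(\<integral>\<^sup>+\<omega>. ennreal (of_bool (active (clk \<omega>) r s)) \<partial>M) = ennreal (active_prob r s)"
    unfolding active_prob_def
    by (intro nn_integral_eq_integral integrable_const_bound[of _ 1]) auto
  moreover have "ennreal (of_bool b) = of_bool b" for b by (cases b) auto
  ultimately show ?thesis by simp
qed

lemma active_prob_le:
  assumes "0 \<le> s"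
  shows "active_prob r s \<le> (1 - exp (- s)) ^ r"
\<comment> \<open>For \<open>r = 0\<close> the intersection \<open>?A\<close> below would have an
  empty index set and be the whole type instead of an event.\<close>
proof (cases "r = 0")
  case True
  then show ?thesis by (simp add: active_prob_def active_def prob_space)
next
  case False
  let ?J = "{..<r} \<times> {0::nat}"
  let ?A = "\<Inter>i\<in>?J. (case i of (r, n) \<Rightarrow> W r n) -` {..s} \<inter> space M"
  have A: "?A \<in> sets M" using False by (intro sets.finite_INT) auto
  have "prob ?A = (\<Prod>i\<in>?J. prob ((case i of (r, n) \<Rightarrow> W r n) -` {..s} \<inter> space M))"
    using False by (intro indep_varsD[OF waiting_times_indep]) auto
  also have "\<dots> = (\<Prod>i\<in>?J. 1 - exp (- s))"
  proof -
    have "prob (W q 0 -` {..s} \<inter> space M) = 1 - exp (- s)" for q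
      using exponential_distributedD_le[OF waiting_time_exponential[of q 0] assms]
      by (simp add: vimage_def Int_def conj_commute)
    then show ?thesis by (intro prod.cong refl) (auto split: prod.split)
  qed
  also have "\<dots> = (1 - exp (- s)) ^ r" by (simp add: card_cartesian_product)
  finally have prob: "prob ?A = (1 - exp (- s)) ^ r" .
  have "ennreal (active_prob r s) \<le> (\<integral>\<^sup>+\<omega>. indicator ?A \<omega> \<partial>M)"
    unfolding nn_integral_active[symmetric]
  proof (rule nn_integral_mono_AE)
    show "AE \<omega> in M. of_bool (active (clk \<omega>) r s) \<le> (indicator ?A \<omega> :: ennreal)"
      using AE_proper_clocks AE_space
    proof eventually_elim
      case (elim \<omega>)
      show ?case
      proof (cases "active (clk \<omega>) r s")
        case True
        then have "\<omega> \<in> ?A" using active_imp_rung[OF elim(1) True] elim(2) by auto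
        then show ?thesis by simp
      qed simp
    qed
  qed
  also have "\<dots> = ennreal ((1 - exp (- s)) ^ r)"
    using A by (simp only: nn_integral_indicator emeasure_eq_measure prob)
  finally show ?thesis using assms by (simp add: ennreal_le_iff)
qed

lemma isCont_active_prob: "isCont (active_prob r) s"
proof (subst continuous_at_sequentially, intro allI impI)
  fix x :: "nat \<Rightarrow> real" assume x: "x \<longlonglongrightarrow> s"
  have "(\<lambda>n. active_prob r (x n)) \<longlonglongrightarrow> active_prob r s"
    unfolding active_prob_def
  proof (rule integral_dominated_convergence[where w = "\<lambda>_. 1"])
    show "AE \<omega> in M. (\<lambda>n. of_bool (active (clk \<omega>) r (x n)))
        \<longlonglongrightarrow> (of_bool (active (clk \<omega>) r s) :: real)"
      \<comment> \<open>The null set depends on the limit \<open>s\<close> only: off it, each path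
        is constant near \<open>s\<close>.\<close>
      using AE_proper_clocks AE_no_ring_at[of s]
    proof eventually_elim
      case (elim \<omega>)
      have "\<forall>\<^sub>F t in nhds s. active (clk \<omega>) r t \<longleftrightarrow> active (clk \<omega>) r s"
        using elim by (intro eventually_active) auto
      then have "\<forall>\<^sub>F n in sequentially. active (clk \<omega>) r (x n) \<longleftrightarrow> active (clk \<omega>) r s"
        using x by (rule eventually_compose_filterlim)
      then show ?case by (intro tendsto_eventually) (auto elim: eventually_mono)
    qed
  qed auto
  then show "(active_prob r \<circ> x) \<longlonglongrightarrow> active_prob r s" by (simp add: o_def)
qed

text \<open>Given all other waiting times, the ring occurs at a fixed time plus an independent
  exponential variable, so \<open>exponential_compensator\<close> spreads it over the preceding
  inter-ring interval.\<close>

lemma expected_jump_at_ring: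
  "(\<integral>\<^sup>+\<omega>. of_bool (ring_time (clk \<omega>) r n \<le> t \<and>
      can_jump (clk \<omega>) r n (ring_time (clk \<omega>) r n)) \<partial>M) =
    (\<integral>\<^sup>+\<omega>. (\<integral>\<^sup>+s. of_bool ((\<Sum>j<n. W r j \<omega>) \<le> s \<and> s < ring_time (clk \<omega>) r n \<and> 0 \<le> s \<and>
      can_jump (clk \<omega>) r n s) * indicator {..t} s \<partial>lborel) \<partial>M)"
proof -
  let ?A = "{(r, n)}" and ?B = "UNIV - {(r, n)}"
  let ?S = "\<Pi>\<^sub>M i\<in>?A. (borel :: real measure)" and ?T = "\<Pi>\<^sub>M i\<in>?B. (borel :: real measure)"
  define X where "X \<omega> = restrict (\<lambda>i. (case i of (r, n) \<Rightarrow> W r n) \<omega>) ?A" for \<omega>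
  define Y where "Y \<omega> = restrict (\<lambda>i. (case i of (r, n) \<Rightarrow> W r n) \<omega>) ?B" for \<omega>
  \<comment> \<open>\<open>V\<close> rebuilds the clocks from all waiting times except \<open>(r, n)\<close>; the \<open>0\<close> put there is never read.\<close>
  define V :: "(nat \<times> nat \<Rightarrow> real) \<Rightarrow> clocks"
    where "V y a b = (if (a, b) = (r, n) then 0 else y (a, b))" for y a b
  define base where "base y = (\<Sum>j<n. V y r j)" for y
  \<comment> \<open>The first argument is a trial value \<open>u\<close> of the waiting time;
    \<open>base y + u\<close> is the resulting ring time.\<close>
  define h :: "real \<times> (nat \<times> nat \<Rightarrow> real) \<Rightarrow> ennreal"
    where "h z = of_bool (base (snd z) + fst z \<le> t \<and>
      can_jump (\<lambda>a b. V (snd z) a b) r n (base (snd z) + fst z))" for z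
  have V[measurable]: "(\<lambda>y. V y a b) \<in> borel_measurable ?T" for a b
    unfolding V_def by (cases "(a, b) = (r, n)") (auto intro: measurable_component_singleton)
  have [measurable]: "base \<in> borel_measurable ?T"
    unfolding base_def by measurable
  have h: "h \<in> borel_measurable (borel \<Otimes>\<^sub>M ?T)"
    unfolding h_def by measurable
  have indep: "indep_var ?S X ?T Y"
    unfolding X_def Y_def by (rule indep_var_restrict[OF waiting_times_indep]) auto
  have X: "X \<omega> (r, n) = W r n \<omega>" for \<omega>
    by (simp add: X_def)
  have V_Y: "(a, b) \<noteq> (r, n) \<Longrightarrow> V (Y \<omega>) a b = W a b \<omega>" for a b \<omega>
    by (auto simp: V_def Y_def)
  have base: "base (Y \<omega>) = (\<Sum>j<n. W r j \<omega>)" for \<omega>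
    unfolding base_def by (rule sum.cong) (auto simp: V_Y)
  have h_Y: "h (u, Y \<omega>) = of_bool ((\<Sum>j<n. W r j \<omega>) + u \<le> t \<and>
      can_jump (clk \<omega>) r n ((\<Sum>j<n. W r j \<omega>) + u))" for u \<omega>
  proof -
    have "can_jump (\<lambda>a b. V (Y \<omega>) a b) r n s = can_jump (clk \<omega>) r n s" for s
      by (rule can_jump_cong) (auto simp: V_Y)
    then show ?thesis by (simp add: h_def base)
  qed
  have "(\<integral>\<^sup>+\<omega>. of_bool (ring_time (clk \<omega>) r n \<le> t \<and>
      can_jump (clk \<omega>) r n (ring_time (clk \<omega>) r n)) \<partial>M) = (\<integral>\<^sup>+\<omega>. h (X \<omega> (r, n), Y \<omega>) \<partial>M)"
    by (simp add: h_Y X ring_time_eq)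
  also have "\<dots> = (\<integral>\<^sup>+\<omega>. (\<integral>\<^sup>+u. h (u, Y \<omega>) * indicator {0..<X \<omega> (r, n)} u \<partial>lborel) \<partial>M)"
  proof (rule exponential_compensator[OF indep _ _ h, where \<phi> = "\<lambda>f. f (r, n)"])
    show "(\<lambda>f. f (r, n)) \<in> borel_measurable ?S"
      by (rule measurable_component_singleton) simp
    show "distributed M lborel (\<lambda>\<omega>. X \<omega> (r, n)) (exponential_density 1)"
      unfolding X by (rule waiting_time_exponential)
  qed
  also have "\<dots> = (\<integral>\<^sup>+\<omega>. (\<integral>\<^sup>+s. of_bool ((\<Sum>j<n. W r j \<omega>) \<le> s \<and> s < ring_time (clk \<omega>) r n \<and>
      0 \<le> s \<and> can_jump (clk \<omega>) r n s) * indicator {..t} s \<partial>lborel) \<partial>M)"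
  proof (rule nn_integral_cong_AE)
    show "AE \<omega> in M. (\<integral>\<^sup>+u. h (u, Y \<omega>) * indicator {0..<X \<omega> (r, n)} u \<partial>lborel) =
      (\<integral>\<^sup>+s. of_bool ((\<Sum>j<n. W r j \<omega>) \<le> s \<and> s < ring_time (clk \<omega>) r n \<and> 0 \<le> s \<and>
        can_jump (clk \<omega>) r n s) * indicator {..t} s \<partial>lborel)"
      using AE_proper_clocks
    proof eventually_elim
      case (elim \<omega>)
      \<comment> \<open>The substitution \<open>s = b + u\<close> passes from elapsed waiting time
        to absolute time; \<open>0 \<le> b\<close> makes the condition \<open>0 \<le> s\<close>
        automatic.\<close>
      define b where "b = (\<Sum>j<n. W r j \<omega>)"
      define f where "f s = (of_bool (b \<le> s \<and> s < ring_time (clk \<omega>) r n \<and> 0 \<le> s \<and>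
        can_jump (clk \<omega>) r n s) * indicator {..t} s :: ennreal)" for s
      have "0 \<le> b"
        unfolding b_def by (rule sum_nonneg) (use proper_pos[OF elim] in \<open>auto intro: less_imp_le\<close>)
      have [measurable]: "Measurable.pred borel (can_jump (clk \<omega>) r n)"
        by (rule measurable_can_jump_at)
      have [measurable]: "f \<in> borel_measurable borel"
        unfolding f_def by measurable
      have "(\<integral>\<^sup>+s. f s \<partial>lborel) = (\<integral>\<^sup>+u. f (b + u) \<partial>lborel)"
        using nn_integral_real_affine[of f 1 b] by simp
      also have "\<dots> = (\<integral>\<^sup>+u. h (u, Y \<omega>) * indicator {0..<X \<omega> (r, n)} u \<partial>lborel)"
      proof (rule nn_integral_cong)
        fix u
        show "f (b + u) = h (u, Y \<omega>) * indicator {0..<X \<omega> (r, n)} u"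
          using \<open>0 \<le> b\<close> unfolding f_def h_Y X ring_time_eq b_def[symmetric]
          by (auto split: split_indicator)
      qed
      finally show ?case by (simp add: f_def b_def)
    qed
  qed
  finally show ?thesis .
qed

lemma expected_particle_jumps:
  "(\<integral>\<^sup>+\<omega>. of_nat (jumps (clk \<omega>) r t) \<partial>M) =
    (\<integral>\<^sup>+s. ennreal (active_prob r s) * indicator {0..t} s \<partial>lborel)"
proof -
  interpret MB: pair_sigma_finite M lborel ..
  let ?f = "\<lambda>n \<omega> s. of_bool ((\<Sum>j<n. W r j \<omega>) \<le> s \<and> s < ring_time (clk \<omega>) r n \<and> 0 \<le> s \<and>
      can_jump (clk \<omega>) r n s) :: ennreal"
  have [measurable]: "Measurable.pred borel (can_jump (clk \<omega>) r n)" for \<omega> n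
    by (rule measurable_can_jump_at)
  have "(\<integral>\<^sup>+\<omega>. of_nat (jumps (clk \<omega>) r t) \<partial>M) =
      (\<integral>\<^sup>+\<omega>. (\<Sum>n. of_bool (ring_time (clk \<omega>) r n \<le> t \<and>
        can_jump (clk \<omega>) r n (ring_time (clk \<omega>) r n))) \<partial>M)"
    by (rule nn_integral_cong_AE, use AE_proper_clocks in eventually_elim) (rule jumps_eq)
  also have "\<dots> = (\<Sum>n. \<integral>\<^sup>+\<omega>. of_bool (ring_time (clk \<omega>) r n \<le> t \<and>
        can_jump (clk \<omega>) r n (ring_time (clk \<omega>) r n)) \<partial>M)"
    by (rule nn_integral_suminf) measurable
  also have "\<dots> = (\<Sum>n. \<integral>\<^sup>+\<omega>. (\<integral>\<^sup>+s. ?f n \<omega> s * indicator {..t} s \<partial>lborel) \<partial>M)"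
    unfolding expected_jump_at_ring ..
  also have "\<dots> = (\<integral>\<^sup>+\<omega>. (\<Sum>n. \<integral>\<^sup>+s. ?f n \<omega> s * indicator {..t} s \<partial>lborel) \<partial>M)"
    by (rule nn_integral_suminf[symmetric]) measurable
  also have "\<dots> = (\<integral>\<^sup>+\<omega>. (\<integral>\<^sup>+s. (\<Sum>n. ?f n \<omega> s) * indicator {..t} s \<partial>lborel) \<partial>M)"
    by (subst nn_integral_suminf[symmetric]) simp_all
  also have "\<dots> = (\<integral>\<^sup>+\<omega>. (\<integral>\<^sup>+s. of_bool (can_jump (clk \<omega>) r (rings_until (clk \<omega>) r s) s) *
      indicator {0..t} s \<partial>lborel) \<partial>M)"
  proof (rule nn_integral_cong_AE)
    show "AE \<omega> in M. (\<integral>\<^sup>+s. (\<Sum>n. ?f n \<omega> s) * indicator {..t} s \<partial>lborel) =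
      (\<integral>\<^sup>+s. of_bool (can_jump (clk \<omega>) r (rings_until (clk \<omega>) r s) s) *
        indicator {0..t} s \<partial>lborel)"
      using AE_proper_clocks
    proof eventually_elim
      case (elim \<omega>)
      show ?case
        unfolding sum_over_ring_intervals[OF elim]
        by (rule nn_integral_cong) (auto split: split_indicator)
    qed
  qed
  \<comment> \<open>Fubini comes before replacing \<open>can_jump\<close> by \<open>active\<close>:
    with \<open>s\<close> fixed, almost surely no clock rings at \<open>s\<close>.\<close>
  also have "\<dots> = (\<integral>\<^sup>+s. (\<integral>\<^sup>+\<omega>. of_bool (can_jump (clk \<omega>) r (rings_until (clk \<omega>) r s) s) *
      indicator {0..t} s \<partial>M) \<partial>lborel)"
    by (rule MB.Fubini'[symmetric]) measurable
  also have "\<dots> = (\<integral>\<^sup>+s. ennreal (active_prob r s) * indicator {0..t} s \<partial>lborel)"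
  proof (rule nn_integral_cong)
    fix s :: real
    have "(\<integral>\<^sup>+\<omega>. of_bool (can_jump (clk \<omega>) r (rings_until (clk \<omega>) r s) s) *
        indicator {0..t} s \<partial>M) = (\<integral>\<^sup>+\<omega>. of_bool (active (clk \<omega>) r s) * indicator {0..t} s \<partial>M)"
    proof (rule nn_integral_cong_AE)
      show "AE \<omega> in M. of_bool (can_jump (clk \<omega>) r (rings_until (clk \<omega>) r s) s) *
          indicator {0..t} s = of_bool (active (clk \<omega>) r s) * (indicator {0..t} s :: ennreal)"
        using AE_proper_clocks AE_no_ring_at[of s]
        by eventually_elim (simp add: can_jump_iff_active)
    qed
    also have "\<dots> = ennreal (active_prob r s) * indicator {0..t} s"
      by (simp add: nn_integral_multc nn_integral_active)
    finally show "(\<integral>\<^sup>+\<omega>. of_bool (can_jump (clk \<omega>) r (rings_until (clk \<omega>) r s) s) *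
        indicator {0..t} s \<partial>M) = ennreal (active_prob r s) * indicator {0..t} s" .
  qed
  finally show ?thesis .
qed

subsection \<open>Summation over the particles\<close>

definition mean_active :: "real \<Rightarrow> real" where
  "mean_active s = (\<Sum>r. active_prob r s)"

lemma summable_exp_bound: "0 \<le> s \<Longrightarrow> summable (\<lambda>r. (1 - exp (- s)) ^ r :: real)"
  by (rule summable_geometric) simp

lemma summable_active_prob: "0 \<le> s \<Longrightarrow> summable (\<lambda>r. active_prob r s)"
  by (rule summable_comparison_test'[OF summable_exp_bound, of _ 0])
    (auto simp: active_prob_nonneg intro: active_prob_le)

lemma suminf_active_prob: "0 \<le> s \<Longrightarrow> (\<Sum>r. ennreal (active_prob r s)) = ennreal (mean_active s)"
  unfolding mean_active_def
  by (rule suminf_ennreal2) (simp_all add: active_prob_nonneg summable_active_prob)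

lemma mean_active_nonneg: "0 \<le> s \<Longrightarrow> 0 \<le> mean_active s"
  unfolding mean_active_def by (rule suminf_nonneg) (simp_all add: active_prob_nonneg summable_active_prob)

lemma continuous_on_mean_active: "continuous_on {0..b} mean_active"
proof -
  \<comment> \<open>The geometric bound increases with time, so its value at \<open>b\<close> is a
    uniform majorant for the Weierstrass test.\<close>
  have bound: "norm (active_prob r s) \<le> (1 - exp (- b)) ^ r" if "s \<in> {0..b}" for r s
  proof -
    have "active_prob r s \<le> (1 - exp (- s)) ^ r" using that by (simp add: active_prob_le)
    also have "\<dots> \<le> (1 - exp (- b)) ^ r" using that by (intro power_mono) auto
    finally show ?thesis by (simp add: active_prob_nonneg)
  qed
  show ?thesis
  proof (cases "0 \<le> b")
    case True
    have "uniform_limit {0..b} (\<lambda>n s. \<Sum>r<n. active_prob r s) mean_active sequentially"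
      unfolding mean_active_def
      by (rule Weierstrass_m_test[OF bound]) (simp_all add: summable_exp_bound True)
    then show ?thesis
      by (rule uniform_limit_theorem[rotated])
        (auto intro!: always_eventually continuous_on_sum continuous_at_imp_continuous_on
          continuous_sum isCont_active_prob)
  qed simp
qed

lemma nn_integral_tasep_a:
  assumes "0 \<le> s"
  shows "(\<integral>\<^sup>+\<omega>. tasep_a W s \<omega> \<partial>M) = ennreal (mean_active s)"
proof -
  have "(\<integral>\<^sup>+\<omega>. tasep_a W s \<omega> \<partial>M) = (\<integral>\<^sup>+\<omega>. (\<Sum>r. of_bool (active (clk \<omega>) r s)) \<partial>M)"
    unfolding tasep_a_def
    by (rule nn_integral_cong_AE, use AE_proper_clocks in eventually_elim) (rule active_count_eq)
  also have "\<dots> = (\<Sum>r. \<integral>\<^sup>+\<omega>. of_bool (active (clk \<omega>) r s) \<partial>M)"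
    by (rule nn_integral_suminf) measurable
  finally show ?thesis using assms by (simp add: nn_integral_active suminf_active_prob)
qed

text \<open>Tonelli sums the particle identities under the integral; continuity of
  \<open>mean_active\<close> then makes the result finite and a Henstock-Kurzweil integral.\<close>

lemma expected_jumps_eq:
  assumes "0 \<le> t"
  shows "expected_jumps M W t = ennreal (integral {0..t} mean_active)"
proof -
  have [measurable]: "active_prob r \<in> borel_measurable borel" for r
    by (intro borel_measurable_continuous_onI continuous_at_imp_continuous_on ballI isCont_active_prob)
  have [measurable]: "(\<lambda>\<omega>. of_nat (jumps (clk \<omega>) r t) :: ennreal) \<in> borel_measurable M" for r
    unfolding jumps_def by measurable
  have "expected_jumps M W t = (\<Sum>r. \<integral>\<^sup>+\<omega>. of_nat (jumps (clk \<omega>) r t) \<partial>M)"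
    unfolding expected_jumps_def tasep_P_def total_jumps_def by (rule nn_integral_suminf) measurable
  also have "\<dots> = (\<integral>\<^sup>+s. (\<Sum>r. ennreal (active_prob r s) * indicator {0..t} s) \<partial>lborel)"
    unfolding expected_particle_jumps by (rule nn_integral_suminf[symmetric]) measurable
  also have "\<dots> = (\<integral>\<^sup>+s. ennreal (mean_active s) * indicator {0..t} s \<partial>lborel)"
    by (rule nn_integral_cong) (auto simp: suminf_active_prob split: split_indicator)
  also have "\<dots> = ennreal (integral {0..t} mean_active)"
    by (rule nn_integral_has_integral_lebesgue')
      (auto simp: mean_active_nonneg intro!: integrable_integral integrable_continuous_real continuous_on_mean_active)
  finally show ?thesis .
qed

lemma expected_jumps_has_real_derivative:
  assumes "0 < t"
  shows "((\<lambda>s. enn2real (expected_jumps M W s)) has_real_derivative mean_active t) (at t)"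
proof -
  \<comment> \<open>The right end \<open>t + 1\<close> makes \<open>t\<close> an interior point,
    which gives the two-sided derivative.\<close>
  have "((\<lambda>s. integral {0..s} mean_active) has_real_derivative mean_active t) (at t within {0..t + 1})"
    using assms by (intro integral_has_real_derivative continuous_on_mean_active) auto
  then have "((\<lambda>s. integral {0..s} mean_active) has_real_derivative mean_active t) (at t)"
    using assms by (simp add: at_within_Icc_at)
  then show ?thesis
  proof (rule has_field_derivative_transform_within_open[where S = "{0<..}"])
    show "integral {0..s} mean_active = enn2real (expected_jumps M W s)" if "s \<in> {0<..}" for s
    proof -
      have "0 \<le> integral {0..s} mean_active"
        by (intro integral_nonneg integrable_continuous_real continuous_on_mean_active)
          (simp add: mean_active_nonneg)
      then show ?thesis using that by (simp add: expected_jumps_eq)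
    qed
  qed (use assms in auto)
qed

end

text \<open>\<open>enn2real\<close> sends infinity to \<open>0\<close>, and for nonmeasurable
  functions the integral is only a lower integral. Measurability and finiteness in the conclusion
  ensure that the derivative formula concerns genuine expectations.\<close>

theorem theorem5p1:
  fixes M :: "'a measure" and W :: "nat \<Rightarrow> nat \<Rightarrow> 'a \<Rightarrow> real"
  assumes "tasep_clocks M W"
  shows "(\<forall>t\<ge>0. tasep_P W t \<in> borel_measurable M \<and> expected_jumps M W t < \<infinity>) \<and>
    (\<forall>t>0. tasep_a W t \<in> borel_measurable M \<and> (\<integral>\<^sup>+\<omega>. tasep_a W t \<omega> \<partial>M) < \<infinity> \<and>
      ((\<lambda>s. enn2real (expected_jumps M W s)) has_real_derivative
        enn2real (\<integral>\<^sup>+\<omega>. tasep_a W t \<omega> \<partial>M)) (at t))"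
proof -
  interpret tasep_clocks M W by (fact assms)
  have "tasep_P W t \<in> borel_measurable M" "tasep_a W t \<in> borel_measurable M" for t
    unfolding tasep_P_def tasep_a_def
    by (intro measurable_total_jumps measurable_active_count measurable_W)+
  then show ?thesis
    using expected_jumps_has_real_derivative
    by (simp add: expected_jumps_eq nn_integral_tasep_a mean_active_nonneg)
qed

end
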